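(* For any may-must argumentation $F=(A,R,f_Q)$, $1\le|\Gamma[F]|\le|\mathcal{L}|^{|A|\cdot|\mathcal{L}|^{|A|}}$; and for any abstract dialectical framework $G=(A,R,C)$, $1\le|\Delta[G]|\le\left(\frac{(|A|+2)(|A|+3)}{2}\right)^{2|A|}$. Moreover, $\left(\frac{(|A|+2)(|A|+3)}{2}\right)^{2|A|}<|\mathcal{L}|^{|A|\cdot|\mathcal{L}|^{|A|}}$ for every $|A|\ge2$, where $|\mathcal{L}|=3$.
   Context: Labels: $\mathcal{L}=\{\mathsf{in},\mathsf{out},\mathsf{undec}\}$. For a finite set $S$ of arguments, $\Lambda^S$ is the set of total functions $S\to\mathcal{L}$. A nuance tuple is $((n_1,n_2),(m_1,m_2))\in\mathbb{N}^4$ with $n_1\le n_2$, $m_1\le m_2$. A may-must argumentation (MMA) is $(A,R,f_Q)$ with $A$ finite, $R\subseteq A\times A$, $f_Q$ assigning a nuance tuple to each argument. $\mathrm{pre}(a)=\{b\in A:(b,a)\in R\}$. For $\lambda$ a labelling, $o_\lambda(a)$ (resp. $i_\lambda(a)$) is the number of $b\in\mathrm{pre}(a)$ with $\lambda(b)=\mathsf{out}$ (resp. $\mathsf{in}$). With $f_Q(a)=((n_1,n_2),(m_1,m_2))$: may-a iff $n_1\le o_\lambda(a)$; must-a iff $n_2\le o_\lambda(a)$; may$_s$-a iff $n_1\le o_\lambda(a)<n_2$; not-a iff $o_\lambda(a)<n_1$; may-r, must-r, may$_s$-r, not-r likewise with $m_1,m_2,i_\lambda(a)$. $\lambda$ designates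 $l$ for $a$ in the MMA iff $\lambda$ is defined on all of $\mathrm{pre}(a)$ and: $l=\mathsf{in}$ requires may-a and not must-r; $l=\mathsf{out}$ requires may-r and not must-a; $l=\mathsf{undec}$ requires (must-a and must-r) or may$_s$-a or may$_s$-r or (not-a and not-r). An abstract dialectical framework (ADF) is $(A,R,C)$ with $C=(C_a)_{a\in A}$, $C_a:\Lambda^{\mathrm{pre}(a)}\to\mathcal{L}$. $\Gamma[F]$ (concretisations of an MMA $F=(A,R,f_Q)$): all ADFs $(A,R,C)$ with, for every $a\in A$ and $\lambda\in\Lambda^{\mathrm{pre}(a)}$, $\lambda$ designating $C_a(\lambda)$ for $a$ in $F$. $\Delta[G]$ (abstractions of an ADF $G=(A,R,C)$): all MMAs $(A,R,f_Q)$ such that for every $a\in A$, writing $f_Q(a)=((n_1,n_2),(m_1,m_2))$, we have $n_2\le|\mathrm{pre}(a)|+1$ and $m_2\le|\mathrm{pre}(a)|+1$, and for every $\lambda\in\Lambda^{\mathrm{pre}(a)}$ (with $o=o_\lambda(a)$, $i=i_\lambda(a)$): if $o<n_1,i<m_1$ then $C_a(\lambda)=\mathsf{undec}$; if $n_1\le o<n_2,i<m_1$ then $C_a(\lambda)\in\{\mathsf{in},\mathsf{undec}\}$; if $n_2\le o,i<m_1$ then $C_a(\lambda)=\mathsf{in}$; if $o<n_1,m_1\le i<m_2$ then $C_a(\lambda)\in\{\mathsf{out},\mathsf{undec}\}$; if $n_1\le o<n_2,m_1\le i<m_2$ then $C_a(\lambda)$ is arbitrary; if $n_2\le o,m_1\le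 i<m_2$ then $C_a(\lambda)\in\{\mathsf{in},\mathsf{undec}\}$; if $o<n_1,m_2\le i$ then $C_a(\lambda)=\mathsf{out}$; if $n_1\le o<n_2,m_2\le i$ then $C_a(\lambda)\in\{\mathsf{out},\mathsf{undec}\}$; if $n_2\le o,m_2\le i$ then $C_a(\lambda)=\mathsf{undec}$. *)

theory Defs
  imports Main "HOL-Library.FuncSet"
begin

datatype label = In | Out | Undec

text \<open>A labelling is a partial map, so that being defined on all predecessors is a real
  condition; the total functions on \<open>S\<close> are the maps with domain exactly \<open>S\<close>.\<close>

type_synonym 'a labelling = "'a \<Rightarrow> label option"

definition labellings :: "'a set \<Rightarrow> 'a labelling set" where
  "labellings S = {lam. dom lam = S}"

type_synonym nuance = "(nat \<times> nat) \<times> (nat \<times> nat)"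

definition nuance_tuples :: "nuance set" where
  "nuance_tuples = {((n1, n2), (m1, m2)) | n1 n2 m1 m2. n1 \<le> n2 \<and> m1 \<le> m2}"

definition pre :: "'a set \<Rightarrow> 'a rel \<Rightarrow> 'a \<Rightarrow> 'a set" where
  "pre A R a = {b \<in> A. (b, a) \<in> R}"

definition num_out :: "'a set \<Rightarrow> 'a rel \<Rightarrow> 'a labelling \<Rightarrow> 'a \<Rightarrow> nat" where
  "num_out A R lam a = card {b \<in> pre A R a. lam b = Some Out}"

definition num_in :: "'a set \<Rightarrow> 'a rel \<Rightarrow> 'a labelling \<Rightarrow> 'a \<Rightarrow> nat" where
  "num_in A R lam a = card {b \<in> pre A R a. lam b = Some In}"

type_synonym 'a mma = "'a set \<times> 'a rel \<times> ('a \<Rightarrow> nuance)"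

type_synonym 'a adf = "'a set \<times> 'a rel \<times> ('a \<Rightarrow> 'a labelling \<Rightarrow> label)"

text \<open>The component functions below are extensional (\<open>undefined\<close> off their domain), so that
  every mathematical MMA or ADF has exactly one representation; the cardinalities of sets of
  these structures depend on this.\<close>

fun is_mma :: "'a mma \<Rightarrow> bool" where
  "is_mma (A, R, f) \<longleftrightarrow> finite A \<and> R \<subseteq> A \<times> A \<and> f \<in> A \<rightarrow>\<^sub>E nuance_tuples"

fun is_adf :: "'a adf \<Rightarrow> bool" where
  "is_adf (A, R, C) \<longleftrightarrow> finite A \<and> R \<subseteq> A \<times> A \<and>
     C \<in> (\<Pi>\<^sub>E a\<in>A. labellings (pre A R a) \<rightarrow>\<^sub>E (UNIV :: label set))"

text \<open>The next four take a pair of thresholds and a count: with \<open>(n1, n2)\<close> and \<open>num_out\<close> they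
  are the acceptance conditions (may-a, ...), with \<open>(m1, m2)\<close> and \<open>num_in\<close> the rejection
  conditions (may-r, ...).\<close>

definition may_cond :: "nat \<times> nat \<Rightarrow> nat \<Rightarrow> bool" where
  "may_cond p k \<longleftrightarrow> fst p \<le> k"

definition must_cond :: "nat \<times> nat \<Rightarrow> nat \<Rightarrow> bool" where
  "must_cond p k \<longleftrightarrow> snd p \<le> k"

definition may_s_cond :: "nat \<times> nat \<Rightarrow> nat \<Rightarrow> bool" where
  "may_s_cond p k \<longleftrightarrow> fst p \<le> k \<and> k < snd p"

definition not_cond :: "nat \<times> nat \<Rightarrow> nat \<Rightarrow> bool" where
  "not_cond p k \<longleftrightarrow> k < fst p"

fun designates :: "'a mma \<Rightarrow> 'a labelling \<Rightarrow> label \<Rightarrow> 'a \<Rightarrow> bool" where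
  "designates (A, R, f) lam l a \<longleftrightarrow> pre A R a \<subseteq> dom lam \<and>
     (let n = fst (f a); m = snd (f a); k = num_out A R lam a; j = num_in A R lam a in
      case l of
        In \<Rightarrow> may_cond n k \<and> \<not> must_cond m j
      | Out \<Rightarrow> may_cond m j \<and> \<not> must_cond n k
      | Undec \<Rightarrow> (must_cond n k \<and> must_cond m j) \<or> may_s_cond n k \<or> may_s_cond m j
                 \<or> (not_cond n k \<and> not_cond m j))"

fun concretisations :: "'a mma \<Rightarrow> 'a adf set" where
  "concretisations (A, R, f) = {(A, R, C) | C. is_adf (A, R, C) \<and>
     (\<forall>a\<in>A. \<forall>lam\<in>labellings (pre A R a). designates (A, R, f) lam (C a lam) a)}"

text \<open>The omitted case \<open>n1 \<le> k < n2\<close>, \<open>m1 \<le> j < m2\<close> leaves the label arbitrary.\<close>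

definition abstraction_cond :: "nuance \<Rightarrow> nat \<Rightarrow> nat \<Rightarrow> label \<Rightarrow> bool" where
  "abstraction_cond q k j l \<longleftrightarrow> (case q of ((n1, n2), (m1, m2)) \<Rightarrow>
     (k < n1 \<and> j < m1 \<longrightarrow> l = Undec) \<and>
     (n1 \<le> k \<and> k < n2 \<and> j < m1 \<longrightarrow> l \<in> {In, Undec}) \<and>
     (n2 \<le> k \<and> j < m1 \<longrightarrow> l = In) \<and>
     (k < n1 \<and> m1 \<le> j \<and> j < m2 \<longrightarrow> l \<in> {Out, Undec}) \<and>
     (n2 \<le> k \<and> m1 \<le> j \<and> j < m2 \<longrightarrow> l \<in> {In, Undec}) \<and>
     (k < n1 \<and> m2 \<le> j \<longrightarrow> l = Out) \<and>
     (n1 \<le> k \<and> k < n2 \<and> m2 \<le> j \<longrightarrow> l \<in> {Out, Undec}) \<and>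
     (n2 \<le> k \<and> m2 \<le> j \<longrightarrow> l = Undec))"

fun abstractions :: "'a adf \<Rightarrow> 'a mma set" where
  "abstractions (A, R, C) = {(A, R, f) | f. is_mma (A, R, f) \<and>
     (\<forall>a\<in>A. snd (fst (f a)) \<le> card (pre A R a) + 1 \<and>
            snd (snd (f a)) \<le> card (pre A R a) + 1 \<and>
            (\<forall>lam\<in>labellings (pre A R a).
               abstraction_cond (f a) (num_out A R lam a) (num_in A R lam a) (C a lam)))}"

end

theory Submission imports Defs begin

text \<open>Some label is always designated: if the accepting and the rejecting thresholds agree
  (both must, both not) or one of them is strictly may, then \<open>Undec\<close>; otherwise exactly one of the
  two sides is must, which gives \<open>In\<close> or \<open>Out\<close>. Every ADF has the trivial abstraction
  \<open>((0, p + 1), (0, p + 1))\<close> with \<open>p\<close> the number of predecessors, since neither count ever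
  reaches \<open>p + 1\<close>. The upper bounds count functions into finite sets; in an abstraction both
  threshold pairs satisfy \<open>n1 \<le> n2 \<le> p + 1 \<le> |A| + 1\<close>, so each is one of
  \<open>(|A| + 2) (|A| + 3) / 2\<close>. For the last inequality, that triangular number is at most
  \<open>3 ^ (n + 1)\<close>, and \<open>2 (n + 1) < 3 ^ n\<close>.\<close>

lemma UNIV_label: "(UNIV :: label set) = {In, Out, Undec}"
  using label.exhaust by auto

lemma finite_UNIV_label: "finite (UNIV :: label set)"
  by (simp add: UNIV_label)

lemma card_UNIV_label: "card (UNIV :: label set) = 3"
  by (simp add: UNIV_label)

text \<open>Labellings are partial maps, while the library counts extensional functions. Exchanging
  the default \<open>undefined\<close> for \<open>None\<close> off \<open>S\<close> carries
  finiteness and cardinality over.\<close>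

lemma bij_betw_labellings:
  "bij_betw (\<lambda>g x. if x \<in> S then Some (g x) else None)
     (S \<rightarrow>\<^sub>E (UNIV :: label set)) (labellings S)"
proof (rule bij_betw_byWitness[where f' = "\<lambda>lam. restrict (the \<circ> lam) S"])
  show "\<forall>g\<in>S \<rightarrow>\<^sub>E (UNIV :: label set).
      restrict (the \<circ> (\<lambda>x. if x \<in> S then Some (g x) else None)) S = g"
    by (simp add: fun_eq_iff PiE_iff extensional_def)
  show "\<forall>lam\<in>labellings S.
      (\<lambda>x. if x \<in> S then Some (restrict (the \<circ> lam) S x) else None) = lam"
    by (auto simp: labellings_def fun_eq_iff domIff)
qed (auto simp: labellings_def dom_def)

lemma finite_labellings: "finite S \<Longrightarrow> finite (labellings S)"
  using bij_betw_finite[OF bij_betw_labellings, of S] finite_PiE[of S "\<lambda>_. UNIV :: label set"]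
    finite_UNIV_label by simp

lemma card_labellings: "finite S \<Longrightarrow> card (labellings S) = 3 ^ card S"
  using bij_betw_same_card[OF bij_betw_labellings, of S] by (simp add: card_PiE card_UNIV_label)

lemma finite_pre: "finite A \<Longrightarrow> finite (pre A R a)"
  by (simp add: pre_def)

lemma card_pre_le: "finite A \<Longrightarrow> card (pre A R a) \<le> card A"
  by (auto simp: pre_def intro: card_mono)

text \<open>The number of choices varies with the predecessors of each argument; a uniform bound on
  the factors turns the product into a power.\<close>

lemma card_PiE_le_power:
  assumes "finite A" and "\<And>a. a \<in> A \<Longrightarrow> finite (B a)" and "\<And>a. a \<in> A \<Longrightarrow> card (B a) \<le> N"
  shows "card (\<Pi>\<^sub>E a\<in>A. B a) \<le> N ^ card A"
  using prod_mono[of A "\<lambda>a. card (B a)" "\<lambda>_. N"] assms by (simp add: card_PiE)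

lemma designates_exists:
  assumes "f a \<in> nuance_tuples" and "pre A R a \<subseteq> dom lam"
  shows "\<exists>l. designates (A, R, f) lam l a"
proof -
  obtain n1 n2 m1 m2 where f: "f a = ((n1, n2), (m1, m2))" "n1 \<le> n2" "m1 \<le> m2"
    using assms(1) by (auto simp: nuance_tuples_def)
  let ?D = "\<lambda>l. designates (A, R, f) lam l a"
  \<comment> \<open>The orderings \<open>n1 \<le> n2\<close> and \<open>m1 \<le> m2\<close> make
    must imply may, so a side that alone is must also meets the may condition of its label.\<close>
  have "?D In \<or> ?D Out \<or> ?D Undec"
    using assms(2) f
    by (auto simp: Let_def may_cond_def must_cond_def may_s_cond_def not_cond_def)
  then show ?thesis by blast
qed

lemma concretisations_card:
  assumes "is_mma (A, R, f)"
  shows "1 \<le> card (concretisations (A, R, f))"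
    and "card (concretisations (A, R, f)) \<le> 3 ^ (card A * 3 ^ card A)"
proof -
  have A: "finite A" "R \<subseteq> A \<times> A" "\<And>a. a \<in> A \<Longrightarrow> f a \<in> nuance_tuples"
    using assms by auto
  let ?B = "\<lambda>a. labellings (pre A R a) \<rightarrow>\<^sub>E (UNIV :: label set)"
  let ?P = "\<Pi>\<^sub>E a\<in>A. ?B a"
  have finB: "finite (?B a)" for a
    using A(1) by (intro finite_PiE finite_labellings finite_pre finite_UNIV_label)
  have finP: "finite ?P"
    by (rule finite_PiE[OF A(1) finB])
  have sub: "concretisations (A, R, f) \<subseteq> (\<lambda>C. (A, R, C)) ` ?P"
    by auto
  have "card (?B a) = 3 ^ 3 ^ card (pre A R a)" for a
    using A(1) by (simp add: card_PiE finite_labellings finite_pre card_labellings card_UNIV_label)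
  then have "card (?B a) \<le> 3 ^ 3 ^ card A" for a
    using card_pre_le[OF A(1)] by (simp add: power_increasing)
  then have "card ?P \<le> (3 ^ 3 ^ card A) ^ card A"
    using A(1) finB by (intro card_PiE_le_power)
  moreover have "card (concretisations (A, R, f)) \<le> card ?P"
    using finP sub by (rule surj_card_le)
  ultimately show "card (concretisations (A, R, f)) \<le> 3 ^ (card A * 3 ^ card A)"
    by (simp add: mult.commute[of "card A"] power_mult)
  \<comment> \<open>Choose any designated label; both restrictions give the extensionality required
    by \<open>is_adf\<close>.\<close>
  define C where "C = (\<lambda>a\<in>A. \<lambda>lam\<in>labellings (pre A R a). SOME l. designates (A, R, f) lam l a)"
  have "designates (A, R, f) lam (C a lam) a"
    if "a \<in> A" "lam \<in> labellings (pre A R a)" for a lam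
  proof -
    have "\<exists>l. designates (A, R, f) lam l a"
      using that A(3) by (intro designates_exists) (auto simp: labellings_def)
    from someI_ex[OF this] show ?thesis
      using that unfolding C_def by (simp del: designates.simps)
  qed
  moreover have "is_adf (A, R, C)"
    using A by (auto simp: C_def)
  ultimately have "(A, R, C) \<in> concretisations (A, R, f)"
    by (simp del: is_adf.simps designates.simps)
  \<comment> \<open>An infinite set has \<open>card\<close> 0, so a member alone does not give the
    lower bound.\<close>
  moreover have "finite (concretisations (A, R, f))"
    using sub finP by (blast intro: finite_subset[OF _ finite_imageI])
  ultimately show "1 \<le> card (concretisations (A, R, f))"
    by (metis One_nat_def Suc_leI card_gt_0_iff empty_iff)
qed

text \<open>The dependent sum picks the upper threshold first; the converse restores the order of a
  nuance tuple.\<close>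

definition threshold_pairs :: "nat \<Rightarrow> (nat \<times> nat) set" where
  "threshold_pairs N = (SIGMA y:{..N}. {..y})\<inverse>"

lemma mem_threshold_pairs: "(x, y) \<in> threshold_pairs N \<longleftrightarrow> x \<le> y \<and> y \<le> N"
  by (auto simp: threshold_pairs_def)

lemma finite_threshold_pairs: "finite (threshold_pairs N)"
  by (auto simp: threshold_pairs_def)

lemma card_threshold_pairs: "card (threshold_pairs N) = (N + 1) * (N + 2) div 2"
proof -
  have "card (threshold_pairs N) = (\<Sum>y\<le>N. Suc y)"
    by (simp add: threshold_pairs_def card_SigmaI)
  also have "\<dots> = (N + 1) * (N + 2) div 2"
    by (induction N) (auto simp: algebra_simps)
  finally show ?thesis .
qed

lemma abstractions_card:
  assumes "is_adf (A, R, C)"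
  shows "1 \<le> card (abstractions (A, R, C))"
    and "card (abstractions (A, R, C)) \<le> ((card A + 2) * (card A + 3) div 2) ^ (2 * card A)"
proof -
  have A: "finite A" "R \<subseteq> A \<times> A"
    using assms by auto
  let ?T = "threshold_pairs (card A + 1)"
  let ?P = "A \<rightarrow>\<^sub>E ?T \<times> ?T"
  have finP: "finite ?P"
    using A(1) by (intro finite_PiE finite_cartesian_product finite_threshold_pairs)
  have sub: "abstractions (A, R, C) \<subseteq> (\<lambda>f. (A, R, f)) ` ?P"
  proof
    fix F assume "F \<in> abstractions (A, R, C)"
    then obtain f where f: "F = (A, R, f)" "f \<in> A \<rightarrow>\<^sub>E nuance_tuples"
      "\<And>a. a \<in> A \<Longrightarrow> snd (fst (f a)) \<le> card (pre A R a) + 1 \<and> snd (snd (f a)) \<le> card (pre A R a) + 1"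
      by auto
    have "f a \<in> ?T \<times> ?T" if "a \<in> A" for a
    proof -
      have "f a \<in> nuance_tuples"
        using f(2) that by auto
      then show ?thesis
        using f(3)[OF that] card_pre_le[OF A(1), of R a]
        by (auto simp: nuance_tuples_def mem_threshold_pairs)
    qed
    then show "F \<in> (\<lambda>f. (A, R, f)) ` ?P"
      using f(1,2) by (intro image_eqI[of _ _ f] PiE_I) (blast intro: PiE_arb)+
  qed
  have "card (abstractions (A, R, C)) \<le> card ?P"
    using finP sub by (rule surj_card_le)
  also have "\<dots> = (card ?T * card ?T) ^ card A"
    using A(1) by (simp add: card_PiE card_cartesian_product)
  also have "card ?T = (card A + 2) * (card A + 3) div 2"
    unfolding card_threshold_pairs by (simp add: eval_nat_numeral)
  finally show "card (abstractions (A, R, C)) \<le> ((card A + 2) * (card A + 3) div 2) ^ (2 * card A)"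
    by (simp add: power_mult power2_eq_square)
  define f :: "'a \<Rightarrow> nuance" where
    "f = (\<lambda>a\<in>A. ((0, card (pre A R a) + 1), (0, card (pre A R a) + 1)))"
  have "num_out A R lam a < card (pre A R a) + 1" "num_in A R lam a < card (pre A R a) + 1" for lam a
    using finite_pre[OF A(1), of R a]
    by (auto simp: num_out_def num_in_def less_Suc_eq_le intro: card_mono)
  \<comment> \<open>Both counts lie between 0 and \<open>card (pre A R a)\<close>, which is the
    strictly-may case on both sides: every premise in \<open>abstraction_cond\<close> fails, so any
    label \<open>l\<close> is allowed.\<close>
  then have "abstraction_cond (f a) (num_out A R lam a) (num_in A R lam a) l" if "a \<in> A" for a lam l
    using that by (auto simp: f_def abstraction_cond_def simp flip: not_less)
  moreover have "is_mma (A, R, f)"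
    using A by (auto simp: f_def nuance_tuples_def)
  ultimately have "(A, R, f) \<in> abstractions (A, R, C)"
    by (simp add: f_def)
  moreover have "finite (abstractions (A, R, C))"
    using sub finP by (blast intro: finite_subset[OF _ finite_imageI])
  ultimately show "1 \<le> card (abstractions (A, R, C))"
    by (metis One_nat_def Suc_leI card_gt_0_iff empty_iff)
qed

text \<open>Once the left side is bounded by a power of 3, only the exponents
  \<open>n * (2 * n + 2)\<close> and \<open>n * 3 ^ n\<close> remain to be compared.\<close>

lemma triangular_power_less:
  assumes "2 \<le> (n :: nat)"
  shows "((n + 2) * (n + 3) div 2) ^ (2 * n) < 3 ^ (n * 3 ^ n)"
proof -
  have "(n + 2) * (n + 3) \<le> 2 * 3 ^ (n + 1)"
    using assms by (induction n rule: dec_induct) (auto simp: algebra_simps)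
  then have "((n + 2) * (n + 3) div 2) ^ (2 * n) \<le> (3 ^ (n + 1)) ^ (2 * n)"
    by (intro power_mono) auto
  also have "\<dots> = 3 ^ (n * (2 * n + 2))"
    unfolding power_mult[symmetric] by (simp add: algebra_simps)
  \<comment> \<open>The induction starts at 2, where it reads 6 < 9; at 1 it would fail, as 4
    exceeds 3.\<close>
  also have "2 * n + 2 < 3 ^ n"
    using assms by (induction n rule: dec_induct) (auto simp: eval_nat_numeral)
  then have "(3 :: nat) ^ (n * (2 * n + 2)) < 3 ^ (n * 3 ^ n)"
    using assms by (intro power_strict_increasing mult_strict_left_mono) auto
  finally show ?thesis .
qed

theorem mainTheorem3:
  "(\<forall>(A :: 'a set) R f. is_mma (A, R, f) \<longrightarrow>
      1 \<le> card (concretisations (A, R, f)) \<and>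
      card (concretisations (A, R, f))
        \<le> card (UNIV :: label set) ^ (card A * card (UNIV :: label set) ^ card A)) \<and>
   (\<forall>(A :: 'a set) R C. is_adf (A, R, C) \<longrightarrow>
      1 \<le> card (abstractions (A, R, C)) \<and>
      card (abstractions (A, R, C)) \<le> (((card A + 2) * (card A + 3)) div 2) ^ (2 * card A)) \<and>
   (\<forall>n :: nat. n \<ge> 2 \<longrightarrow>
      (((n + 2) * (n + 3)) div 2) ^ (2 * n)
        < card (UNIV :: label set) ^ (n * card (UNIV :: label set) ^ n)) \<and>
   card (UNIV :: label set) = 3"
  unfolding card_UNIV_label
  using concretisations_card abstractions_card triangular_power_less by blast

end
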